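(* Fix $z \in \mathbb{R}$ and a positive integer $k$ large enough that $z < 2\sqrt{k-1}$. Let $m$ be any positive integer such that \[ \frac{z}{\sqrt{k-1}} < \alpha_m = 2\cos\!\left(\frac{\pi}{m+1}\right). \] Set $L = k/\sqrt{k-1}$ and define \[ \widehat{F}_m(x) = \frac{\sum_{j=0}^m V_{2j}(x)}{x-\alpha_m}. \] For any real number $s$ with $0 < s < \alpha_m - \frac{z}{\sqrt{k-1}}$, write the function $x \mapsto \widehat{F}_m(x+s)$ as \[ F_{m,s}(x) = \sum_{j=0}^{2m-1} c_j(s) V_j(x), \] and define \[ M_{m,s} = \max_{\frac{z}{\sqrt{k-1}} \le x \le L} F_{m,s}(x) = \widehat{F}_m(L+s). \] Then every finite connected $k$-regular graph $X$ with $\mu_1(X) \le z$ has at most $\frac{M_{m,s}}{c_0(s)}$ vertices; that is, $v(k,z) \le \frac{M_{m,s}}{c_0(s)}$.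
   Context: $U_j$ is the $j$-th Chebyshev polynomial of the second kind, $U_j(\cos\theta)=\sin((j+1)\theta)/\sin\theta$, and $V_j(x) = U_j(x/2)$; so $V_0=1$, $V_1=x$, $V_{j+1}=xV_j-V_{j-1}$. For a finite connected $k$-regular graph $X$, $\mu_1(X)$ is the second largest eigenvalue (with multiplicity) of its adjacency matrix, and $v(k,z)$ is the maximum number of vertices of a finite connected $k$-regular graph $X$ with $\mu_1(X) \le z$. *)

theory Defs
  imports
    "HOL-Analysis.Analysis"
    "HOL-Computational_Algebra.Computational_Algebra"
    "Jordan_Normal_Form.Char_Poly"
    "Graph_Theory.Pair_Digraph"
    "Graph_Theory.Digraph_Component"
begin

section \<open>Chebyshev polynomials\<close>

text \<open>
  The \<open>U\<^sub>j\<close> are given by their recurrence; lemma \<open>cheb_U_cos\<close> is the trigonometric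
  characterisation.
\<close>

fun cheb_U :: "nat \<Rightarrow> real \<Rightarrow> real" where
  "cheb_U 0 x = 1"
| "cheb_U (Suc 0) x = 2 * x"
| "cheb_U (Suc (Suc j)) x = 2 * x * cheb_U (Suc j) x - cheb_U j x"

lemma cheb_U_cos_times_sin: "cheb_U j (cos t) * sin t = sin ((real j + 1) * t)"
proof (induction j "cos t" rule: cheb_U.induct)
  case 1
  show ?case by simp
next
  case 2
  show ?case by (simp add: sin_double)
next
  case (3 j)
  have "sin ((real (Suc (Suc j)) + 1) * t) + sin ((real j + 1) * t)
      = 2 * cos t * sin ((real (Suc j) + 1) * t)"
    using sin_plus_sin[of "(real (Suc (Suc j)) + 1) * t" "(real j + 1) * t"]
    by (simp add: algebra_simps add_divide_distrib)
  with 3 show ?case by (simp add: algebra_simps)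
qed

lemma cheb_U_cos:
  assumes "sin t \<noteq> 0"
  shows "cheb_U j (cos t) = sin ((real j + 1) * t) / sin t"
  using assms cheb_U_cos_times_sin[of j t] by (simp add: field_simps)

definition cheb_V :: "nat \<Rightarrow> real \<Rightarrow> real" where
  "cheb_V j x = cheb_U j (x / 2)"

lemma cheb_V_simps:
  "cheb_V 0 x = 1"
  "cheb_V (Suc 0) x = x"
  "cheb_V (Suc (Suc j)) x = x * cheb_V (Suc j) x - cheb_V j x"
  by (simp_all add: cheb_V_def)

section \<open>The functions \<open>F\<^sub>m\<^sub>,\<^sub>s\<close>\<close>

definition alpha :: "nat \<Rightarrow> real" where
  "alpha m = 2 * cos (pi / (real m + 1))"

text \<open>
  The numerator equals \<open>V\<^sub>m(x)\<^sup>2\<close> and so has a double zero at \<^term>\<open>alpha m\<close> for \<open>m \<ge> 1\<close>. Hence the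
  quotient is a polynomial vanishing at \<^term>\<open>alpha m\<close>, which is also the value that the
  convention \<open>x / 0 = 0\<close> assigns at that point.
\<close>

definition F_hat :: "nat \<Rightarrow> real \<Rightarrow> real" where
  "F_hat m x = (\<Sum>j=0..m. cheb_V (2 * j) x) / (x - alpha m)"

definition F_shift :: "nat \<Rightarrow> real \<Rightarrow> real \<Rightarrow> real" where
  "F_shift m s x = F_hat m (x + s)"

definition L_bound :: "nat \<Rightarrow> real" where
  "L_bound k = real k / sqrt (real k - 1)"

definition M_max :: "real \<Rightarrow> nat \<Rightarrow> nat \<Rightarrow> real \<Rightarrow> real" where
  "M_max z k m s =
     (GREATEST y. y \<in> F_shift m s ` {z / sqrt (real k - 1) .. L_bound k})"

section \<open>Regular graphs and their second eigenvalue\<close>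

text \<open>
  Finite simple graphs are symmetric loop-free digraphs without parallel arcs
  (\<^locale>\<open>pair_graph\<close>); the degree of a vertex is then its out-degree.
\<close>

definition regular_graph :: "nat \<Rightarrow> 'a pair_pre_digraph \<Rightarrow> bool" where
  "regular_graph k X \<longleftrightarrow> (\<forall>u \<in> pverts X. out_degree (with_proj X) u = k)"

definition connected_regular_graph :: "nat \<Rightarrow> 'a pair_pre_digraph \<Rightarrow> bool" where
  "connected_regular_graph k X \<longleftrightarrow>
     pair_graph X \<and> Digraph_Component.connected (with_proj X) \<and> regular_graph k X"

definition vertex_list :: "'a pair_pre_digraph \<Rightarrow> 'a list" where
  "vertex_list X = (SOME xs. distinct xs \<and> set xs = pverts X)"

text \<open>
  The chosen enumeration of the vertices only matters up to simultaneous permutation of rows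
  and columns, which does not change the eigenvalues.
\<close>

definition adj_mat :: "'a pair_pre_digraph \<Rightarrow> real mat" where
  "adj_mat X = mat (card (pverts X)) (card (pverts X))
     (\<lambda>(i, j). if (vertex_list X ! i, vertex_list X ! j) \<in> parcs X then 1 else 0)"

text \<open>
  All eigenvalues of the (real symmetric) adjacency matrix, repeated according to multiplicity,
  in decreasing order.
\<close>

definition adj_eigenvalues :: "'a pair_pre_digraph \<Rightarrow> real list" where
  "adj_eigenvalues X = rev (sorted_list_of_multiset (proots (char_poly (adj_mat X))))"

definition mu1 :: "'a pair_pre_digraph \<Rightarrow> real" where
  "mu1 X = adj_eigenvalues X ! 1"

text \<open>
  Every finite graph is isomorphic to one whose vertices are natural numbers. On \<^typ>\<open>nat\<close>, the
  supremum of a finite nonempty set is its maximum, and the supremum of the empty set is \<open>0\<close>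
  (the case where no graph satisfies the eigenvalue bound).
\<close>

definition v_max :: "nat \<Rightarrow> real \<Rightarrow> nat" where
  "v_max k z =
     Sup {card (pverts X) | X :: nat pair_pre_digraph. connected_regular_graph k X \<and> mu1 X \<le> z}"

end

theory Submission
  imports Defs "Jordan_Normal_Form.Schur_Decomposition"
begin

text \<open>
  The function \<open>F = F\<^sub>m\<^sub>,\<^sub>s\<close> is nonpositive up to \<open>\<alpha>\<^sub>m - s\<close>, hence at every normalised eigenvalue
  \<open>\<lambda> / \<surd>(k - 1)\<close> other than the largest one, where it is at most \<open>F(L)\<close>. On the other hand \<open>F\<close> has
  nonnegative coefficients in the basis \<open>V\<^sub>j\<close>, and \<open>V\<^sub>j(A / \<surd>(k - 1))\<close> is entrywise nonnegative because
  it counts nonbacktracking walks up to scaling. Comparing traces gives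
  \<open>n c\<^sub>0 \<le> tr F(A / \<surd>(k - 1)) \<le> F(L)\<close>.

  The coefficients are nonnegative since products of the \<open>V\<^sub>j\<close> and, for \<open>s \<ge> 0\<close>, translates \<open>V\<^sub>j(x + s)\<close>
  are nonnegative combinations of the \<open>V\<^sub>i\<close>; moreover \<open>F\<^sub>m\<^sub>,\<^sub>0 - V\<^sub>1\<close> is such a combination, and
  \<open>V\<^sub>1(x + s) = V\<^sub>1(x) + s\<close> makes \<open>c\<^sub>0\<close> positive.
\<close>

section \<open>Identities for the \<open>V\<^sub>j\<close>\<close>

text \<open>The recurrence in x reduces the left side to (x - y) V_{n+1}(x) and earlier differences;
  the recurrence in y merges the sums. This gives the factor of V_m at \<open>alpha m\<close>,
  monotonicity and shifts.\<close>

lemma cheb_V_diff: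
  "cheb_V n x - cheb_V n y = (x - y) * (\<Sum>j<n. cheb_V j x * cheb_V (n - 1 - j) y)"
proof (induction n rule: induct_nat_012)
  case (ge2 n)
  \<comment> \<open>For j < n the index n + 1 - j is at least 2, so the recurrence in y applies; the
    terms j = n and j = n + 1 are treated separately.\<close>
  have *: "(\<Sum>j<n. cheb_V j x * cheb_V (Suc n - j) y)
      = y * (\<Sum>j<n. cheb_V j x * cheb_V (n - j) y) - (\<Sum>j<n. cheb_V j x * cheb_V (n - 1 - j) y)"
    unfolding sum_distrib_left sum_subtractf[symmetric]
  proof (rule sum.cong)
    fix j assume "j \<in> {..<n}"
    then have "Suc n - j = Suc (Suc (n - 1 - j))" "n - j = Suc (n - 1 - j)" by auto
    then show "cheb_V j x * cheb_V (Suc n - j) y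
        = y * (cheb_V j x * cheb_V (n - j) y) - cheb_V j x * cheb_V (n - 1 - j) y"
      by (simp add: cheb_V_simps algebra_simps)
  qed simp
  have "cheb_V (Suc (Suc n)) x - cheb_V (Suc (Suc n)) y = (x - y) * cheb_V (Suc n) x
      + y * (cheb_V (Suc n) x - cheb_V (Suc n) y) - (cheb_V n x - cheb_V n y)"
    by (simp add: cheb_V_simps algebra_simps)
  then show ?case
    by (simp add: ge2 * cheb_V_simps) (simp add: algebra_simps)
qed (simp_all add: cheb_V_simps)

text \<open>One step of the product rule V_a V_b = V_{a+b} + V_{a+b-2} + ... + V_{|a-b|}.\<close>

lemma cheb_V_mult_Suc:
  "cheb_V (Suc a) x * cheb_V (Suc b) x = cheb_V (Suc (Suc (a + b))) x + cheb_V a x * cheb_V b x"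
proof (induction b rule: induct_nat_012)
  case (ge2 n)
  have "cheb_V (Suc a) x * cheb_V (Suc (Suc (Suc n))) x
      = x * (cheb_V (Suc a) x * cheb_V (Suc (Suc n)) x) - cheb_V (Suc a) x * cheb_V (Suc n) x"
    by (simp add: cheb_V_simps(3)[of "Suc n"] algebra_simps)
  then show ?case
    by (simp only: ge2) (simp add: cheb_V_simps algebra_simps)
next
  case 1
  show ?case
    by (simp add: cheb_V_simps algebra_simps)
qed (simp add: cheb_V_simps)

lemma sum_cheb_V_even: "(\<Sum>j=0..m. cheb_V (2 * j) x) = (cheb_V m x)\<^sup>2"
proof (induction m)
  case (Suc m)
  then show ?case
    using cheb_V_mult_Suc[of m x m] by (simp add: power2_eq_square mult_2)
qed (simp add: cheb_V_simps)

section \<open>Nonnegative combinations of the \<open>V\<^sub>j\<close>\<close>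

text \<open>The index n bounds the degree; it is tracked so that the final expansion stops at 2m -
  1.\<close>

definition cheb_cone :: "nat \<Rightarrow> (real \<Rightarrow> real) set" where
  "cheb_cone n = {f. \<exists>c. (\<forall>j. 0 \<le> c j) \<and> (\<forall>x. f x = (\<Sum>j=0..n. c j * cheb_V j x))}"

lemma cheb_cone_V: "j \<le> n \<Longrightarrow> cheb_V j \<in> cheb_cone n"
  unfolding cheb_cone_def
  by (rule CollectI, rule exI[of _ "\<lambda>i. of_bool (i = j)"]) (simp add: of_bool_def if_distribR if_distrib[of "\<lambda>a. a * _"] cong: if_cong)

lemma cheb_cone_add:
  assumes "f \<in> cheb_cone n" "g \<in> cheb_cone n"
  shows "(\<lambda>x. f x + g x) \<in> cheb_cone n"
proof -
  from assms obtain c d where "\<forall>j. 0 \<le> c j" "\<forall>x. f x = (\<Sum>j=0..n. c j * cheb_V j x)"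
    "\<forall>j. 0 \<le> d j" "\<forall>x. g x = (\<Sum>j=0..n. d j * cheb_V j x)"
    unfolding cheb_cone_def by blast
  then show ?thesis
    unfolding cheb_cone_def
    by (intro CollectI exI[of _ "\<lambda>j. c j + d j"]) (auto simp: distrib_right sum.distrib)
qed

lemma cheb_cone_scale:
  assumes "f \<in> cheb_cone n" "0 \<le> a"
  shows "(\<lambda>x. a * f x) \<in> cheb_cone n"
proof -
  from assms obtain c where "\<forall>j. 0 \<le> c j" "\<forall>x. f x = (\<Sum>j=0..n. c j * cheb_V j x)"
    unfolding cheb_cone_def by blast
  then show ?thesis
    unfolding cheb_cone_def using assms(2)
    by (intro CollectI exI[of _ "\<lambda>j. a * c j"]) (auto simp: sum_distrib_left mult.assoc)
qed

lemma cheb_cone_sum: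
  assumes "\<And>i. i \<in> S \<Longrightarrow> f i \<in> cheb_cone n"
  shows "(\<lambda>x. \<Sum>i\<in>S. f i x) \<in> cheb_cone n"
proof -
  have zero: "(\<lambda>x. 0) \<in> cheb_cone n"
    using cheb_cone_scale[OF cheb_cone_V[of 0 n], of 0] by simp
  show ?thesis
    using assms by (induction S rule: infinite_finite_induct) (auto simp: zero intro!: cheb_cone_add)
qed

lemma cheb_coneE:
  assumes "f \<in> cheb_cone n"
  obtains c where "\<And>j. 0 \<le> c j" "f = (\<lambda>x. \<Sum>j=0..n. c j * cheb_V j x)"
  using assms unfolding cheb_cone_def by (auto simp: fun_eq_iff)

lemma cheb_cone_mono:
  assumes "f \<in> cheb_cone n" "n \<le> n'"
  shows "f \<in> cheb_cone n'"
proof -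
  from assms(1) obtain c where "\<And>j. 0 \<le> c j" "f = (\<lambda>x. \<Sum>j=0..n. c j * cheb_V j x)"
    by (rule cheb_coneE) blast
  then show ?thesis
    using assms(2) by (auto intro!: cheb_cone_sum cheb_cone_scale cheb_cone_V)
qed

text \<open>\<open>cheb_V_mult_Suc\<close> peels off leading terms until one index is 0.\<close>

lemma cheb_cone_V_mult: "(\<lambda>x. cheb_V a x * cheb_V b x) \<in> cheb_cone (a + b)"
proof (induction a arbitrary: b)
  case 0
  then show ?case
    by (simp add: cheb_V_simps cheb_cone_V)
next
  case (Suc a)
  show ?case
  proof (cases b)
    case 0
    then show ?thesis
      by (simp add: cheb_V_simps(1) cheb_cone_V)
  next
    case (Suc b')
    then show ?thesis
      by (auto simp: cheb_V_mult_Suc intro!: cheb_cone_add cheb_cone_V cheb_cone_mono[OF Suc.IH[of b']])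
  qed
qed

lemma cheb_cone_mult:
  assumes "f \<in> cheb_cone n" "g \<in> cheb_cone n'"
  shows "(\<lambda>x. f x * g x) \<in> cheb_cone (n + n')"
proof -
  obtain c where c: "\<And>j. 0 \<le> c j" and f: "f = (\<lambda>x. \<Sum>j=0..n. c j * cheb_V j x)"
    using assms(1) by (rule cheb_coneE) blast
  obtain d where d: "\<And>j. 0 \<le> d j" and g: "g = (\<lambda>x. \<Sum>j=0..n'. d j * cheb_V j x)"
    using assms(2) by (rule cheb_coneE) blast
  have "(\<lambda>x. f x * g x)
      = (\<lambda>x. \<Sum>i=0..n. \<Sum>j=0..n'. (c i * d j) * (cheb_V i x * cheb_V j x))"
    unfolding f g sum_product by (simp add: mult_ac)
  moreover have "\<dots> \<in> cheb_cone (n + n')"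
    using c d by (intro cheb_cone_sum cheb_cone_scale cheb_cone_mono[OF cheb_cone_V_mult]) auto
  ultimately show ?thesis by simp
qed

text \<open>By \<open>cheb_V_diff\<close> at x + s and x, the shift adds s times products of V_j(x +
  s), j < n, with V_{n-1-j}(x). Strong induction and closure under products apply.\<close>

lemma cheb_cone_V_shift:
  assumes "0 \<le> s"
  shows "(\<lambda>x. cheb_V n (x + s)) \<in> cheb_cone n"
proof (induction n rule: less_induct)
  case (less n)
  have "(\<lambda>x. cheb_V n (x + s))
      = (\<lambda>x. cheb_V n x + s * (\<Sum>j<n. cheb_V j (x + s) * cheb_V (n - 1 - j) x))"
  proof
    fix x
    show "cheb_V n (x + s)
        = cheb_V n x + s * (\<Sum>j<n. cheb_V j (x + s) * cheb_V (n - 1 - j) x)"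
      using cheb_V_diff[of n "x + s" x] by simp
  qed
  moreover have "\<dots> \<in> cheb_cone n"
  proof (intro cheb_cone_add cheb_cone_scale cheb_cone_sum cheb_cone_V assms)
    fix j assume "j \<in> {..<n}"
    then show "(\<lambda>x. cheb_V j (x + s) * cheb_V (n - 1 - j) x) \<in> cheb_cone n"
      by (intro cheb_cone_mono[OF cheb_cone_mult[OF less.IH cheb_cone_V]]) auto
  qed simp
  ultimately show ?case by simp
qed

lemma cheb_cone_shift:
  assumes "f \<in> cheb_cone n" "0 \<le> s"
  shows "(\<lambda>x. f (x + s)) \<in> cheb_cone n"
proof -
  obtain c where c: "\<And>j. 0 \<le> c j" and f: "f = (\<lambda>x. \<Sum>j=0..n. c j * cheb_V j x)"
    using assms(1) by (rule cheb_coneE) blast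
  show ?thesis
    unfolding f using c assms(2)
    by (intro cheb_cone_sum cheb_cone_scale cheb_cone_mono[OF cheb_cone_V_shift]) auto
qed

text \<open>V_{a+1} V_a = V_{2a+1} + V_{2a-1} + ... + V_1, and V_1(x) = x. Splitting off this term
  later makes the constant coefficient positive.\<close>

lemma cheb_cone_V_Suc_mult:
  "(\<lambda>x. cheb_V (Suc a) x * cheb_V a x - x) \<in> cheb_cone (2 * a + 1)"
proof (induction a)
  case 0
  then show ?case
    using cheb_cone_scale[OF cheb_cone_V[of 0 1], of 0] by (simp add: cheb_V_simps)
next
  case (Suc a)
  have "(\<lambda>x. cheb_V (Suc (Suc a)) x * cheb_V (Suc a) x - x)
      = (\<lambda>x. cheb_V (2 * Suc a + 1) x + (cheb_V (Suc a) x * cheb_V a x - x))"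
    by (rule ext) (use cheb_V_mult_Suc[of "Suc a" _ a] in \<open>simp add: mult_2\<close>)
  moreover have "\<dots> \<in> cheb_cone (2 * Suc a + 1)"
    by (intro cheb_cone_add cheb_cone_V cheb_cone_mono[OF Suc.IH]) auto
  ultimately show ?case by simp
qed

section \<open>Linear independence of the V_j\<close>

fun cheb_V_poly :: "nat \<Rightarrow> real poly" where
  "cheb_V_poly 0 = 1"
| "cheb_V_poly (Suc 0) = [:0, 1:]"
| "cheb_V_poly (Suc (Suc j)) = pCons 0 (cheb_V_poly (Suc j)) - cheb_V_poly j"

lemma poly_cheb_V_poly: "poly (cheb_V_poly j) x = cheb_V j x"
  by (induction j rule: cheb_V_poly.induct) (simp_all add: cheb_V_simps)

lemma cheb_V_poly_monic: "Polynomial.degree (cheb_V_poly j) = j \<and> Polynomial.lead_coeff (cheb_V_poly j) = 1"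
proof (induction j rule: cheb_V_poly.induct)
  case (3 j)
  let ?p = "pCons 0 (cheb_V_poly (Suc j))"
  have "cheb_V_poly (Suc j) \<noteq> 0" using 3 by (metis lead_coeff_pCons(2) leading_coeff_0_iff zero_neq_one)
  then have p: "Polynomial.degree ?p = Suc (Suc j)" using 3 by simp
  have "Polynomial.degree (cheb_V_poly (Suc (Suc j))) = Suc (Suc j)"
    unfolding cheb_V_poly.simps diff_conv_add_uminus using 3 p
    by (subst degree_add_eq_left) auto
  moreover have "Polynomial.coeff (cheb_V_poly j) (Suc (Suc j)) = 0"
    using 3 by (intro coeff_eq_0) auto
  ultimately show ?case using 3 by auto
qed auto

text \<open>Since V_j is monic of degree j, the coefficient of x^n in the sum is c_n, so it
  vanishes, and the argument repeats on the shorter sum.\<close>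

lemma cheb_V_coeffs_zero:
  assumes "\<And>x. (\<Sum>j=0..n. c j * cheb_V j x) = 0" "j \<le> n"
  shows "c j = 0"
proof -
  define p where "p n = (\<Sum>j=0..n. Polynomial.smult (c j) (cheb_V_poly j))" for n
  have "p n = 0 \<Longrightarrow> \<forall>j\<le>n. c j = 0" for n
  proof (induction n)
    case 0
    then show ?case by (simp add: p_def)
  next
    case (Suc n)
    have "Polynomial.coeff (p n) (Suc n) = 0"
      unfolding p_def Polynomial.coeff_sum using cheb_V_poly_monic
      by (intro sum.neutral) (auto intro!: coeff_eq_0)
    moreover have "Polynomial.coeff (p (Suc n)) (Suc n) = Polynomial.coeff (p n) (Suc n) + c (Suc n)"
      using cheb_V_poly_monic[of "Suc n"] by (auto simp: p_def)
    ultimately have "c (Suc n) = 0" using Suc.prems by simp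
    moreover from this have "p n = 0" using Suc.prems by (simp add: p_def)
    ultimately show ?case using Suc.IH by (auto simp: le_Suc_eq)
  qed
  \<comment> \<open>A real polynomial is determined by its values, so the pointwise hypothesis
    becomes an identity of polynomials.\<close>
  moreover have "poly (p n) = poly 0"
    using assms(1) by (auto simp: p_def poly_sum poly_cheb_V_poly)
  ultimately show ?thesis using assms(2) by (metis poly_eq_poly_eq_iff)
qed

lemma cheb_V_coeffs_unique:
  assumes "\<And>x. (\<Sum>j=0..n. c j * cheb_V j x) = (\<Sum>j=0..n. d j * cheb_V j x)" "j \<le> n"
  shows "c j = d j"
  using cheb_V_coeffs_zero[where n = n and c = "\<lambda>j. c j - d j" and j = j] assms
  by (simp add: left_diff_distrib sum_subtractf)

section \<open>The function \<open>F\<^sub>m\<^sub>,\<^sub>s\<close>\<close>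

text \<open>With t = pi / (m + 1), V_j(alpha_m) = sin((j + 1) t) / sin t; the angle (j + 1) t lies
  strictly between 0 and pi for j < m and equals pi for j = m.\<close>

lemma cheb_V_alpha:
  assumes "m \<ge> 1"
  shows "sin (pi / (real m + 1)) > 0" "cheb_V m (alpha m) = 0"
    "\<And>j. j < m \<Longrightarrow> 0 < cheb_V j (alpha m)" "alpha m < 2"
proof -
  let ?t = "pi / (real m + 1)"
  have t: "0 < ?t" "?t < pi" using assms by (auto simp: field_simps)
  show sin: "sin ?t > 0" using t by (rule sin_gt_zero)
  have V: "cheb_V j (alpha m) = sin ((real j + 1) * ?t) / sin ?t" for j
    using cheb_U_cos[of ?t j] sin by (simp add: cheb_V_def alpha_def)
  have "(real m + 1) * ?t = pi" by (simp add: field_simps add_eq_0_iff)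
  then show "cheb_V m (alpha m) = 0" unfolding V by simp
  show "0 < cheb_V j (alpha m)" if "j < m" for j
  proof -
    have "sin ((real j + 1) * ?t) > 0"
      using that by (intro sin_gt_zero) (auto simp: field_simps intro!: add_pos_nonneg)
    then show ?thesis unfolding V using sin by simp
  qed
  have "cos ?t < cos 0" using t by (intro cos_monotone_0_pi) auto
  then show "alpha m < 2" by (simp add: alpha_def)
qed

text \<open>The polynomial V_m(x) / (x - alpha_m), read off from \<open>cheb_V_diff\<close> with y =
  alpha_m, where V_m vanishes. For m \<ge> 1 its coefficients are positive.\<close>

definition cheb_quot :: "nat \<Rightarrow> real \<Rightarrow> real" where
  "cheb_quot m x = (\<Sum>j<m. cheb_V (m - 1 - j) (alpha m) * cheb_V j x)"

context
  fixes m :: nat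
  assumes m: "m \<ge> 1"
begin

lemma cheb_V_factor: "cheb_V m x = (x - alpha m) * cheb_quot m x"
  using cheb_V_diff[of m x "alpha m"] cheb_V_alpha(2)[OF m] by (simp add: cheb_quot_def mult.commute)

text \<open>At x = \<open>alpha m\<close> both sides are 0, the left one by division by zero. The
  sign of \<open>F_hat\<close> is now visible.\<close>

lemma F_hat_eq_square: "F_hat m x = (x - alpha m) * (cheb_quot m x)\<^sup>2"
  by (simp add: F_hat_def sum_cheb_V_even cheb_V_factor power2_eq_square)

lemma F_hat_eq_mult: "F_hat m x = cheb_V m x * cheb_quot m x"
  by (simp add: F_hat_eq_square cheb_V_factor power2_eq_square)

lemma F_hat_nonpos: "x \<le> alpha m \<Longrightarrow> F_hat m x \<le> 0"
  by (simp add: F_hat_eq_square mult_nonpos_nonneg)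

text \<open>\<open>cheb_V_diff\<close> based at \<open>alpha m\<close> writes V_j(x) as V_j(alpha_m)
  plus a nonnegative combination of earlier V_i(x).\<close>

lemma cheb_V_nonneg:
  assumes "alpha m \<le> x" "j \<le> m"
  shows "0 \<le> cheb_V j x"
  using assms(2)
proof (induction j rule: less_induct)
  case (less j)
  have "0 \<le> (x - alpha m) * (\<Sum>i<j. cheb_V i x * cheb_V (j - 1 - i) (alpha m))"
    using less assms(1) cheb_V_alpha(3)[OF m]
    by (intro mult_nonneg_nonneg sum_nonneg) (auto intro: less_imp_le)
  moreover have "0 \<le> cheb_V j (alpha m)"
    using cheb_V_alpha(2,3)[OF m] less.prems by (cases "j = m") (auto intro: less_imp_le)
  ultimately show ?case using cheb_V_diff[of j x "alpha m"] by simp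
qed

lemma cheb_V_mono:
  assumes "alpha m \<le> x" "x \<le> y" "j \<le> m"
  shows "cheb_V j x \<le> cheb_V j y"
proof -
  have "0 \<le> (y - x) * (\<Sum>i<j. cheb_V i y * cheb_V (j - 1 - i) x)"
    using assms by (intro mult_nonneg_nonneg sum_nonneg) (auto intro!: cheb_V_nonneg)
  then show ?thesis using cheb_V_diff[of j y x] by simp
qed

text \<open>Left of \<open>alpha m\<close> the function is nonpositive; right of it all factors are
  nonnegative and nondecreasing. Hence the maximum is taken at the right end of the
  interval.\<close>

lemma F_hat_le:
  assumes "x \<le> y" "alpha m \<le> y"
  shows "F_hat m x \<le> F_hat m y"
proof (cases "x \<le> alpha m")
  case True
  have "0 \<le> F_hat m y" using assms(2) by (simp add: F_hat_eq_square)
  with F_hat_nonpos[OF True] show ?thesis by simp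
next
  case False
  have "0 \<le> cheb_quot m x" unfolding cheb_quot_def using False cheb_V_alpha(3)[OF m]
    by (intro sum_nonneg mult_nonneg_nonneg cheb_V_nonneg) (auto intro!: less_imp_le)
  moreover have "cheb_quot m x \<le> cheb_quot m y" unfolding cheb_quot_def using False assms cheb_V_alpha(3)[OF m]
    by (intro sum_mono mult_left_mono cheb_V_mono) (auto intro!: less_imp_le)
  ultimately show ?thesis
    unfolding F_hat_eq_square using False assms by (intro mult_mono power_mono) auto
qed

text \<open>The top term of \<open>cheb_quot m\<close> has coefficient V_0 = 1 and contributes V_m
  V_{m-1}, from which x can be removed; the others give positive multiples of V_m V_j with j < m -
  1.\<close>

lemma F_hat_cone: "(\<lambda>x. F_hat m x - x) \<in> cheb_cone (2 * m - 1)"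
proof -
  from m obtain a where a: "m = Suc a" by (cases m) auto
  have "(\<lambda>x. F_hat m x - x) = (\<lambda>x. (cheb_V (Suc a) x * cheb_V a x - x)
      + (\<Sum>j<a. cheb_V (a - j) (alpha m) * (cheb_V m x * cheb_V j x)))"
    unfolding F_hat_eq_mult
    by (simp add: cheb_quot_def a cheb_V_simps(1) algebra_simps sum_distrib_left)
  moreover have "\<dots> \<in> cheb_cone (2 * m - 1)"
    using cheb_V_alpha(3)[OF m] a
    by (intro cheb_cone_add cheb_cone_sum cheb_cone_scale cheb_cone_mono[OF cheb_cone_V_mult]
        cheb_cone_mono[OF cheb_cone_V_Suc_mult]) (auto intro!: less_imp_le)
  ultimately show ?thesis by simp
qed

text \<open>The shifted cone element \<open>F_hat m (x + s) - (x + s)\<close> misses only V_1(x) + s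
  V_0(x), so c_0 is at least s.\<close>

lemma F_shift_expansion:
  assumes "0 < s"
  obtains c where "\<And>j. 0 \<le> c j" "0 < c 0"
    "\<And>x. F_shift m s x = (\<Sum>j=0..2*m-1. c j * cheb_V j x)"
proof -
  have "(\<lambda>x. cheb_V 1 x + (F_hat m (x + s) - (x + s))) \<in> cheb_cone (2 * m - 1)"
    using m assms cheb_cone_shift[OF F_hat_cone, of s]
    by (intro cheb_cone_add cheb_cone_V) auto
  then obtain d where d: "\<And>j. 0 \<le> d j"
    "(\<lambda>x. cheb_V 1 x + (F_hat m (x + s) - (x + s))) = (\<lambda>x. \<Sum>j=0..2*m-1. d j * cheb_V j x)"
    by (rule cheb_coneE) blast
  have eq: "F_shift m s x = (\<Sum>j=0..2*m-1. (d(0 := d 0 + s)) j * cheb_V j x)" for x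
  proof -
    have "F_shift m s x = s + (\<Sum>j=0..2*m-1. d j * cheb_V j x)"
      using fun_cong[OF d(2), of x] by (simp add: F_shift_def cheb_V_simps(2))
    also have "\<dots> = (\<Sum>j=0..2*m-1. (d(0 := d 0 + s)) j * cheb_V j x)"
      by (simp add: sum.atLeast_Suc_atMost cheb_V_simps(1) algebra_simps)
    finally show ?thesis .
  qed
  show ?thesis
    by (rule that[of "d(0 := d 0 + s)"]) (use d(1) assms eq in \<open>auto simp: add_nonneg_pos\<close>)
qed

end

section \<open>Nonbacktracking walks\<close>

text \<open>\<open>nb_walks S E r u v w\<close> counts the nonbacktracking walks of length \<open>r + 1\<close> from \<open>u\<close> to \<open>w\<close>
  whose first step is \<open>(u, v)\<close>.\<close>

fun nb_walks :: "'a set \<Rightarrow> ('a \<Rightarrow> 'a \<Rightarrow> bool) \<Rightarrow> nat \<Rightarrow> 'a \<Rightarrow> 'a \<Rightarrow> 'a \<Rightarrow> real" where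
  "nb_walks S E 0 u v w = of_bool (v = w)"
| "nb_walks S E (Suc r) u v w = (\<Sum>x | x \<in> S \<and> E v x \<and> x \<noteq> u. nb_walks S E r v x w)"

lemma nb_walks_nonneg: "0 \<le> nb_walks S E r u v w"
  by (induction r arbitrary: u v) (auto intro: sum_nonneg)

text \<open>The entries of \<open>q\<^sup>j V\<^sub>j(A / q)\<close> for the adjacency matrix \<open>A\<close> of \<open>E\<close>, with \<open>c = q\<^sup>2\<close>.\<close>

fun cheb_walks :: "'a set \<Rightarrow> ('a \<Rightarrow> 'a \<Rightarrow> bool) \<Rightarrow> real \<Rightarrow> nat \<Rightarrow> 'a \<Rightarrow> 'a \<Rightarrow> real" where
  "cheb_walks S E c 0 u w = of_bool (u = w)"
| "cheb_walks S E c (Suc 0) u w = of_bool (E u w)"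
| "cheb_walks S E c (Suc (Suc j)) u w
    = (\<Sum>v | v \<in> S \<and> E u v. cheb_walks S E c (Suc j) v w) - c * cheb_walks S E c j u w"

context
  fixes S :: "'a set" and E :: "'a \<Rightarrow> 'a \<Rightarrow> bool" and k :: nat
  assumes fin: "finite S"
    and sym: "\<And>u v. u \<in> S \<Longrightarrow> v \<in> S \<Longrightarrow> E u v \<Longrightarrow> E v u"
    and reg: "\<And>u. u \<in> S \<Longrightarrow> card {v \<in> S. E u v} = k"
begin

text \<open>Nonbacktracking walks of length r + 1 (not r) from u to w, with the first step left
  free.\<close>

definition nb_total :: "nat \<Rightarrow> 'a \<Rightarrow> 'a \<Rightarrow> real" where
  "nb_total r u w = (\<Sum>v | v \<in> S \<and> E u v. nb_walks S E r u v w)"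

lemma nb_walks_Suc:
  assumes "u \<in> S" "v \<in> S" "E u v"
  shows "nb_walks S E (Suc r) u v w = nb_total r v w - nb_walks S E r v u w"
proof -
  have "{x \<in> S. E v x} = insert u {x. x \<in> S \<and> E v x \<and> x \<noteq> u}"
    using assms sym by auto
  then show ?thesis by (simp add: nb_total_def fin)
qed

lemma nb_total_Suc:
  assumes "u \<in> S"
  shows "nb_total (Suc r) u w
    = (\<Sum>v | v \<in> S \<and> E u v. nb_total r v w) - (\<Sum>v | v \<in> S \<and> E u v. nb_walks S E r v u w)"
  unfolding sum_subtractf[symmetric] nb_total_def[of "Suc r"]
  using assms by (intro sum.cong) (auto simp del: nb_walks.simps simp: nb_walks_Suc)

text \<open>Each of the k neighbours v gives one backtracking walk u, v, u, so the full degree k is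
  subtracted.\<close>

lemma nb_total_1:
  assumes "u \<in> S"
  shows "nb_total 1 u w = (\<Sum>v | v \<in> S \<and> E u v. nb_total 0 v w) - real k * of_bool (u = w)"
  using nb_total_Suc[OF assms, of 0 w] reg[OF assms] by simp

text \<open>After backtracking u, v, u the walk continues from u with a first step other than v.
  Over the k neighbours v, each continuation is counted k - 1 times.\<close>

lemma nb_total_Suc_Suc:
  assumes "u \<in> S"
  shows "nb_total (Suc (Suc r)) u w
    = (\<Sum>v | v \<in> S \<and> E u v. nb_total (Suc r) v w) - (real k - 1) * nb_total r u w"
proof -
  have "(\<Sum>v | v \<in> S \<and> E u v. nb_walks S E (Suc r) v u w)
      = (\<Sum>v | v \<in> S \<and> E u v. nb_total r u w - nb_walks S E r u v w)"
    using assms sym by (intro sum.cong) (auto simp del: nb_walks.simps simp: nb_walks_Suc)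
  also have "\<dots> = (real k - 1) * nb_total r u w"
    using reg[OF assms] by (simp add: sum_subtractf nb_total_def[symmetric] algebra_simps)
  finally show ?thesis using nb_total_Suc[OF assms, of "Suc r" w] by simp
qed

text \<open>A walk counted by \<open>V\<^sub>j\<close> is a nonbacktracking walk of length \<open>j\<close>, \<open>j - 2\<close>, \<open>j - 4\<close>, etc.\<close>

lemma cheb_walks_Suc_Suc:
  assumes "u \<in> S" "w \<in> S"
  shows "cheb_walks S E (real k - 1) (Suc (Suc j)) u w
    = cheb_walks S E (real k - 1) j u w + nb_total (Suc j) u w"
  using assms(1)
proof (induction j arbitrary: u rule: induct_nat_012)
  case 0
  have "nb_total 0 v w = of_bool (E v w)" for v
    using assms(2) fin by (simp add: nb_total_def of_bool_def)
  \<comment> \<open>The recurrence of \<open>cheb_walks\<close> subtracts k - 1 where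
    \<open>nb_total_1\<close> subtracts k; the difference is the identity matrix.\<close>
  then show ?case using nb_total_1[OF 0, of w] by (simp add: algebra_simps)
next
  case 1
  have t0: "nb_total 0 v w = of_bool (E v w)" for v
    using assms(2) fin by (simp add: nb_total_def of_bool_def)
  have c2: "cheb_walks S E (real k - 1) (Suc (Suc 0)) v w = of_bool (v = w) + nb_total 1 v w"
    if "v \<in> S" for v
    using nb_total_1[OF that, of w] t0 by (simp add: algebra_simps)
  have "cheb_walks S E (real k - 1) (Suc (Suc 1)) u w
      = (\<Sum>v | v \<in> S \<and> E u v. of_bool (v = w) + nb_total 1 v w) - (real k - 1) * nb_total 0 u w"
    using c2 t0 by simp
  also have "\<dots> = of_bool (E u w) + nb_total 2 u w"
    using nb_total_Suc_Suc[OF 1, of 0 w] assms(2) fin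
    by (simp add: sum.distrib of_bool_def numeral_2_eq_2)
  finally show ?case by (simp add: numeral_2_eq_2)
next
  case (ge2 n)
  have "cheb_walks S E (real k - 1) (Suc (Suc (Suc (Suc n)))) u w
      = (\<Sum>v | v \<in> S \<and> E u v. cheb_walks S E (real k - 1) (Suc n) v w + nb_total (Suc (Suc n)) v w)
        - (real k - 1) * (cheb_walks S E (real k - 1) n u w + nb_total (Suc n) u w)"
    using ge2 by (simp only: cheb_walks.simps(3)[of _ _ _ "Suc (Suc n)"])
      (auto simp: ge2 simp del: cheb_walks.simps)
  then show ?case
    using nb_total_Suc_Suc[OF ge2(3), of "Suc n" w]
    by (simp add: sum.distrib algebra_simps)
qed

lemma cheb_walks_nonneg:
  assumes "w \<in> S" "u \<in> S"
  shows "0 \<le> cheb_walks S E (real k - 1) j u w"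
proof (induction j rule: induct_nat_012)
  case (ge2 n)
  have "0 \<le> nb_total (Suc n) u w"
    unfolding nb_total_def by (intro sum_nonneg nb_walks_nonneg)
  with ge2 show ?case by (simp add: cheb_walks_Suc_Suc assms del: cheb_walks.simps)
qed auto

end

section \<open>Spectra of real symmetric matrices\<close>

text \<open>The form Q = v* A v equals e N with N the squared norm of v, real and nonzero; Q is its
  own conjugate because A is real and symmetric.\<close>

lemma symmetric_real_eigenvalue:
  fixes A :: "real mat"
  assumes A: "A \<in> carrier_mat n n"
    and sym: "\<And>i j. i < n \<Longrightarrow> j < n \<Longrightarrow> A $$ (i, j) = A $$ (j, i)"
    and ev: "eigenvalue (map_mat of_real A) (e :: complex)"
  shows "e \<in> \<real>"
proof -
  let ?C = "map_mat complex_of_real A"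
  obtain v where v: "v \<in> carrier_vec n" "v \<noteq> 0\<^sub>v n" and Cv: "?C *\<^sub>v v = e \<cdot>\<^sub>v v"
    using ev A unfolding eigenvalue_def eigenvector_def by auto
  have row: "(\<Sum>j<n. of_real (A $$ (i, j)) * v $ j) = e * v $ i" if i: "i < n" for i
  proof -
    have "(?C *\<^sub>v v) $ i = (\<Sum>j<n. of_real (A $$ (i, j)) * v $ j)"
      using i A v(1) by (simp add: scalar_prod_def lessThan_atLeast0)
    then show ?thesis using Cv v(1) i by simp
  qed
  define N where "N = (\<Sum>i<n. cnj (v $ i) * v $ i)"
  define Q where "Q = (\<Sum>i<n. \<Sum>j<n. cnj (v $ i) * (of_real (A $$ (i, j)) * v $ j))"
  have QN: "Q = e * N"
    by (simp add: Q_def N_def row sum_distrib_left[symmetric]) (simp add: sum_distrib_left mult_ac)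
  have "cnj Q = (\<Sum>i<n. \<Sum>j<n. v $ i * (of_real (A $$ (i, j)) * cnj (v $ j)))"
    by (simp add: Q_def)
  also have "\<dots> = (\<Sum>j<n. \<Sum>i<n. v $ i * (of_real (A $$ (i, j)) * cnj (v $ j)))"
    by (rule sum.swap)
  also have "\<dots> = Q"
    unfolding Q_def by (intro sum.cong) (simp_all add: sym mult_ac)
  finally have "cnj Q = Q" .
  moreover have N: "N = of_real (\<Sum>i<n. (cmod (v $ i))\<^sup>2)"
    by (simp add: N_def complex_norm_square mult.commute del: of_real_power)
  ultimately have "cnj e * N = e * N" using QN by simp
  moreover have "N \<noteq> 0"
  proof -
    obtain i where "i < n" "v $ i \<noteq> 0"
      using v by (metis carrier_vecD eq_vecI index_zero_vec)
    then have "0 < (\<Sum>i<n. (cmod (v $ i))\<^sup>2)"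
      by (intro sum_pos2[of _ i]) auto
    then show ?thesis unfolding N of_real_eq_0_iff by simp
  qed
  ultimately have "cnj e = e" by simp
  then show ?thesis by (simp add: Reals_cnj_iff)
qed

text \<open>The complex factorization has only real roots and pulls back along the injective
  embedding of real polynomials.\<close>

lemma symmetric_char_poly_splits:
  fixes A :: "real mat"
  assumes A: "A \<in> carrier_mat n n"
    and sym: "\<And>i j. i < n \<Longrightarrow> j < n \<Longrightarrow> A $$ (i, j) = A $$ (j, i)"
  obtains es where "char_poly A = (\<Prod>e\<leftarrow>es. [:- e, 1:])" "length es = n"
proof -
  let ?C = "map_mat complex_of_real A"
  have C: "?C \<in> carrier_mat n n" using A by simp
  obtain as where as: "char_poly ?C = (\<Prod>a\<leftarrow>as. [:- a, 1:])" and len: "length as = n"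
    using char_poly_factorized[OF C] by blast
  interpret of_real_poly: map_poly_inj_comm_ring_hom complex_of_real ..
  have real: "a \<in> \<real>" if "a \<in> set as" for a
  proof (rule symmetric_real_eigenvalue[OF A sym])
    show "eigenvalue ?C a"
      unfolding eigenvalue_root_char_poly[OF C] as
      using that by (force simp: poly_prod_list prod_list_zero_iff)
  qed auto
  have as_Re: "map (of_real \<circ> Re) as = as"
    using real by (intro map_idI) simp
  have "map_poly complex_of_real (char_poly A) = char_poly ?C"
    by (rule of_real_hom.char_poly_hom[OF A, symmetric])
  also have "\<dots> = (\<Prod>a\<leftarrow>map (of_real \<circ> Re) as. [:- a, 1:])"
    unfolding as as_Re ..
  also have "\<dots> = map_poly complex_of_real (\<Prod>e\<leftarrow>map Re as. [:- e, 1:])"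
    by (simp add: of_real_poly.hom_prod_list o_def)
  finally have "char_poly A = (\<Prod>e\<leftarrow>map Re as. [:- e, 1:])"
    by (rule of_real_poly.injectivity)
  then show ?thesis using len by (intro that[of "map Re as"]) auto
qed

lemma proots_linear_factors: "proots (\<Prod>e\<leftarrow>es. [:- e, 1:]) = mset (es :: real list)"
proof -
  have "proots (\<Prod>e\<leftarrow>es. [:- e, 1:]) = (\<Sum>e\<leftarrow>es. {#e#})"
  proof -
    have "0 \<notin> set (map (\<lambda>e. [:- e, 1:]) es)" by auto
    from proots_prod_list[OF this] show ?thesis by (simp add: o_def)
  qed
  also have "\<dots> = mset es" by (induction es) auto
  finally show ?thesis .
qed

text \<open>At a coordinate of v of largest modulus M, the eigenvector equation gives |e| M \<le> r
  M.\<close>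

lemma eigenvalue_le_row_sum:
  fixes A :: "real mat"
  assumes A: "A \<in> carrier_mat n n"
    and nonneg: "\<And>i j. i < n \<Longrightarrow> j < n \<Longrightarrow> 0 \<le> A $$ (i, j)"
    and row: "\<And>i. i < n \<Longrightarrow> (\<Sum>j<n. A $$ (i, j)) = r"
    and ev: "eigenvalue A e"
  shows "e \<le> r"
proof -
  obtain v where v: "v \<in> carrier_vec n" "v \<noteq> 0\<^sub>v n" and Av: "A *\<^sub>v v = e \<cdot>\<^sub>v v"
    using ev A unfolding eigenvalue_def eigenvector_def by auto
  obtain i0 where i0: "i0 < n" "v $ i0 \<noteq> 0"
    using v by (metis carrier_vecD eq_vecI index_zero_vec)
  define M where "M = Max ((\<lambda>i. \<bar>v $ i\<bar>) ` {..<n})"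
  have "M \<in> (\<lambda>i. \<bar>v $ i\<bar>) ` {..<n}"
    unfolding M_def using i0 by (intro Max_in) auto
  then obtain i where i: "i < n" "M = \<bar>v $ i\<bar>" by auto
  have le: "\<bar>v $ j\<bar> \<le> M" if "j < n" for j
    unfolding M_def using that by (intro Max_ge) auto
  have pos: "0 < M" using le[OF i0(1)] i0(2) by linarith
  have "(A *\<^sub>v v) $ i = (\<Sum>j<n. A $$ (i, j) * v $ j)"
    using i(1) A v(1) by (simp add: scalar_prod_def lessThan_atLeast0)
  then have "e * v $ i = (\<Sum>j<n. A $$ (i, j) * v $ j)"
    using Av v(1) i(1) by simp
  then have "\<bar>e\<bar> * M = \<bar>\<Sum>j<n. A $$ (i, j) * v $ j\<bar>"
    using i(2) by (metis abs_mult)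
  also have "\<dots> \<le> (\<Sum>j<n. A $$ (i, j) * M)"
    using i(1) by (intro order_trans[OF sum_abs] sum_mono)
      (auto simp: abs_mult intro!: mult_mono le nonneg)
  also have "\<dots> = r * M" by (simp add: sum_distrib_right[symmetric] row i(1))
  finally show ?thesis using pos by simp
qed

section \<open>Traces of Chebyshev polynomials of a matrix\<close>

text \<open>\<open>cheb_mat (q\<^sup>2) A j\<close> is \<open>q\<^sup>j V\<^sub>j(A / q)\<close>; the scaling avoids square roots in the entries.\<close>

fun cheb_mat :: "real \<Rightarrow> real mat \<Rightarrow> nat \<Rightarrow> real mat" where
  "cheb_mat c A 0 = 1\<^sub>m (dim_row A)"
| "cheb_mat c A (Suc 0) = A"
| "cheb_mat c A (Suc (Suc j)) = A * cheb_mat c A (Suc j) - c \<cdot>\<^sub>m cheb_mat c A j"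

lemma cheb_mat_carrier: "A \<in> carrier_mat n n \<Longrightarrow> cheb_mat c A j \<in> carrier_mat n n"
  by (induction c A j rule: cheb_mat.induct) auto

text \<open>Conjugation respects products, differences and scalar multiples; in products the inner Q
  P cancels.\<close>

lemma cheb_mat_similar:
  assumes "similar_mat_wit A B P Q" "A \<in> carrier_mat n n"
  shows "cheb_mat c A j = P * cheb_mat c B j * Q"
proof -
  note w = similar_mat_witD2[OF assms(2,1)]
  note B = w(5) and P = w(6) and Q = w(7)
  note cB = cheb_mat_carrier[OF B, of c]
  show ?thesis
  proof (induction j rule: induct_nat_012)
    case 0
    have "cheb_mat c A 0 = 1\<^sub>m n" using assms(2) by simp
    also have "\<dots> = P * 1\<^sub>m n * Q" unfolding right_mult_one_mat[OF P] w(1) ..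
    also have "1\<^sub>m n = cheb_mat c B 0" using B by simp
    finally show ?case .
  next
    case 1
    show ?case unfolding cheb_mat.simps by (rule w(3))
  next
    case (ge2 j)
    let ?X = "cheb_mat c B (Suc j)" and ?Y = "cheb_mat c B j"
    have X: "?X \<in> carrier_mat n n" and Y: "?Y \<in> carrier_mat n n" by (rule cB)+
    have PX: "P * ?X \<in> carrier_mat n n" and PY: "P * ?Y \<in> carrier_mat n n"
      and PB: "P * B \<in> carrier_mat n n" and BX: "B * ?X \<in> carrier_mat n n"
      and cY: "c \<cdot>\<^sub>m ?Y \<in> carrier_mat n n" and PBX: "P * (B * ?X) \<in> carrier_mat n n"
      using P B X Y by simp_all
    have "P * B * Q * (P * ?X * Q) = P * B * Q * (P * ?X) * Q"
      by (rule assoc_mult_mat[OF mult_carrier_mat[OF PB Q] PX Q, symmetric])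
    also have "P * B * Q * (P * ?X) = P * B * (Q * (P * ?X))"
      by (rule assoc_mult_mat[OF PB Q PX])
    also have "Q * (P * ?X) = ?X"
      unfolding assoc_mult_mat[OF Q P X, symmetric] w(2) by (rule left_mult_one_mat[OF X])
    also have "P * B * ?X = P * (B * ?X)"
      by (rule assoc_mult_mat[OF P B X])
    finally have "A * (P * ?X * Q) = P * (B * ?X) * Q" unfolding w(3)[symmetric] .
    moreover have "c \<cdot>\<^sub>m (P * ?Y * Q) = P * (c \<cdot>\<^sub>m ?Y) * Q"
      unfolding mult_smult_distrib[OF P Y] mult_smult_assoc_mat[OF PY Q] ..
    moreover have "P * (B * ?X - c \<cdot>\<^sub>m ?Y) * Q = P * (B * ?X) * Q - P * (c \<cdot>\<^sub>m ?Y) * Q"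
      unfolding mult_minus_distrib_mat[OF P BX cY]
      by (rule minus_mult_distrib_mat[OF PBX _ Q]) (use P cY in simp)
    ultimately show ?case by (simp only: cheb_mat.simps ge2)
  qed
qed

lemma upper_triangular_mult:
  fixes A B :: "'a :: comm_ring_1 mat"
  assumes "A \<in> carrier_mat n n" "B \<in> carrier_mat n n" "upper_triangular A" "upper_triangular B"
  shows "upper_triangular (A * B)" "i < n \<Longrightarrow> (A * B) $$ (i, i) = A $$ (i, i) * B $$ (i, i)"
proof -
  have e: "(A * B) $$ (i, j) = (\<Sum>l<n. A $$ (i, l) * B $$ (l, j))" if "i < n" "j < n" for i j
    using assms that by (simp add: scalar_prod_def lessThan_atLeast0)
  have z: "A $$ (i, l) = 0" "B $$ (i, l) = 0" if "l < i" "i < n" for i l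
    using assms that by auto
  show "upper_triangular (A * B)"
  proof (rule upper_triangularI)
    fix i j assume "j < i" "i < dim_row (A * B)"
    then have ij: "i < n" "j < i" using assms by auto
    then have "A $$ (i, l) * B $$ (l, j) = 0" if "l < n" for l
      using z(1)[of l i] z(2)[of j l] that by (cases "l < i") auto
    then show "(A * B) $$ (i, j) = 0" using e ij by simp
  qed
  assume i: "i < n"
  have "A $$ (i, l) * B $$ (l, i) = 0" if "l < n" "l \<noteq> i" for l
    using z(1)[of l i] z(2)[of i l] i that by (cases l i rule: linorder_cases) auto
  then have "(\<Sum>l<n. A $$ (i, l) * B $$ (l, i)) = (\<Sum>l\<in>{i}. A $$ (i, l) * B $$ (l, i))"
    using i by (intro sum.mono_neutral_right) auto
  then show "(A * B) $$ (i, i) = A $$ (i, i) * B $$ (i, i)" unfolding e[OF i i] by simp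
qed

text \<open>Diagonals of triangular matrices multiply entrywise, so the matrix recurrence becomes
  the scalar one for q^j V_j.\<close>

lemma cheb_mat_upper_triangular:
  assumes B: "B \<in> carrier_mat n n" "upper_triangular B" and q: "q \<noteq> 0"
  shows "upper_triangular (cheb_mat (q\<^sup>2) B j) \<and>
    (\<forall>i<n. cheb_mat (q\<^sup>2) B j $$ (i, i) = q ^ j * cheb_V j (B $$ (i, i) / q))"
proof (induction j rule: induct_nat_012)
  case 0
  then show ?case using B by (auto simp: cheb_V_simps intro!: upper_triangularI)
next
  case 1
  then show ?case using B q by (auto simp: cheb_V_simps)
next
  case (ge2 j)
  let ?C = "cheb_mat (q\<^sup>2) B"
  note c = cheb_mat_carrier[OF B(1), of "q\<^sup>2"]
  note m = upper_triangular_mult[OF B(1) c B(2) conjunct1[OF ge2(2)]]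
  have entry: "?C (Suc (Suc j)) $$ (i, l) = (B * ?C (Suc j)) $$ (i, l) - q\<^sup>2 * ?C j $$ (i, l)"
    if "i < n" "l < n" for i l
    using that carrier_matD[OF c] carrier_matD[OF B(1)] by (simp del: index_mult_mat(1))
  have "upper_triangular (?C (Suc (Suc j)))"
  proof (rule upper_triangularI)
    fix i l assume "l < i" "i < dim_row (?C (Suc (Suc j)))"
    then have il: "l < i" "i < n" "l < n" using carrier_matD(1)[OF c, of "Suc (Suc j)"] by auto
    have "(B * ?C (Suc j)) $$ (i, l) = 0"
      by (rule upper_triangularD[OF m(1) il(1)]) (use il(2) B(1) in simp)
    moreover have "?C j $$ (i, l) = 0"
      by (rule upper_triangularD[OF conjunct1[OF ge2(1)] il(1)]) (use il(2) carrier_matD(1)[OF c] in simp)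
    ultimately show "?C (Suc (Suc j)) $$ (i, l) = 0" using entry[OF il(2,3)] by simp
  qed
  moreover have "?C (Suc (Suc j)) $$ (i, i) = q ^ Suc (Suc j) * cheb_V (Suc (Suc j)) (B $$ (i, i) / q)"
    if i: "i < n" for i
  proof -
    let ?b = "B $$ (i, i)"
    have "?C (Suc j) $$ (i, i) = q ^ Suc j * cheb_V (Suc j) (?b / q)"
      and "?C j $$ (i, i) = q ^ j * cheb_V j (?b / q)"
      using ge2 i by blast+
    then have "?C (Suc (Suc j)) $$ (i, i)
        = ?b * (q ^ Suc j * cheb_V (Suc j) (?b / q)) - q\<^sup>2 * (q ^ j * cheb_V j (?b / q))"
      using entry[OF i i] m(2)[OF i] by simp
    also have "?b * (q ^ Suc j * cheb_V (Suc j) (?b / q)) = q ^ Suc (Suc j) * (?b / q * cheb_V (Suc j) (?b / q))"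
      using q by simp
    also have "q\<^sup>2 * (q ^ j * cheb_V j (?b / q)) = q ^ Suc (Suc j) * cheb_V j (?b / q)"
      by (simp add: power2_eq_square)
    finally show ?thesis by (simp only: cheb_V_simps(3) right_diff_distrib)
  qed
  ultimately show ?case by blast
qed

lemma trace_comm:
  fixes X Y :: "'a :: comm_ring_1 mat"
  assumes "X \<in> carrier_mat n n" "Y \<in> carrier_mat n n"
  shows "(\<Sum>i<n. (X * Y) $$ (i, i)) = (\<Sum>i<n. (Y * X) $$ (i, i))"
proof -
  have e: "(X * Y) $$ (i, i) = (\<Sum>l<n. X $$ (i, l) * Y $$ (l, i))"
    if "i < n" "X \<in> carrier_mat n n" "Y \<in> carrier_mat n n" for i and X Y :: "'a mat"
    using that by (simp add: scalar_prod_def lessThan_atLeast0)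
  have "(\<Sum>i<n. (X * Y) $$ (i, i)) = (\<Sum>i<n. \<Sum>l<n. X $$ (i, l) * Y $$ (l, i))"
    using assms by (simp add: e del: index_mult_mat(1))
  also have "\<dots> = (\<Sum>l<n. \<Sum>i<n. Y $$ (l, i) * X $$ (i, l))"
    by (subst sum.swap) (simp add: mult.commute)
  also have "\<dots> = (\<Sum>i<n. (Y * X) $$ (i, i))"
    using assms by (simp add: e del: index_mult_mat(1))
  finally show ?thesis .
qed

text \<open>A Schur decomposition gives a similar triangular matrix with diagonal \<open>es\<close>,
  and similarity preserves the trace.\<close>

lemma trace_cheb_mat:
  assumes A: "A \<in> carrier_mat n n" and es: "char_poly A = (\<Prod>e\<leftarrow>es. [:- e, 1:])"
    and q: "q \<noteq> 0"
  shows "(\<Sum>i<n. cheb_mat (q\<^sup>2) A j $$ (i, i)) = q ^ j * (\<Sum>e\<leftarrow>es. cheb_V j (e / q))"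
proof -
  obtain B P Q where BPQ: "schur_decomposition A es = (B, P, Q)" by (cases "schur_decomposition A es") auto
  note s = schur_decomposition[OF A es BPQ]
  then have sim: "similar_mat_wit A B P Q" by simp
  note w = similar_mat_witD2[OF A sim]
  let ?X = "cheb_mat (q\<^sup>2) B j"
  have X: "?X \<in> carrier_mat n n" by (rule cheb_mat_carrier[OF w(5)])
  have es_eq: "es = map (\<lambda>i. B $$ (i, i)) [0..<n]"
    using conjunct2[OF conjunct2[OF s]] carrier_matD(1)[OF w(5)] unfolding diag_mat_def by metis
  have "(\<Sum>i<n. cheb_mat (q\<^sup>2) A j $$ (i, i)) = (\<Sum>i<n. (Q * (P * ?X)) $$ (i, i))"
    unfolding cheb_mat_similar[OF sim A] by (intro trace_comm mult_carrier_mat[OF w(6) X] w(7))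
  also have "Q * (P * ?X) = ?X"
    unfolding assoc_mult_mat[OF w(7,6) X, symmetric] w(2) by (rule left_mult_one_mat[OF X])
  also have "(\<Sum>i<n. ?X $$ (i, i)) = (\<Sum>i<n. q ^ j * cheb_V j (B $$ (i, i) / q))"
    using cheb_mat_upper_triangular[OF w(5) conjunct1[OF conjunct2[OF s]] q, of j]
    by (intro sum.cong) auto
  also have "\<dots> = q ^ j * (\<Sum>e\<leftarrow>es. cheb_V j (e / q))"
    unfolding es_eq
    by (simp add: sum_distrib_left o_def interv_sum_list_conv_sum_set_nat lessThan_atLeast0)
  finally show ?thesis .
qed

section \<open>Regular graphs\<close>

lemma bij_betw_vertex_list:
  assumes "finite (pverts X)"
  shows "bij_betw (\<lambda>i. vertex_list X ! i) {..<card (pverts X)} (pverts X)"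
proof -
  have "distinct (vertex_list X) \<and> set (vertex_list X) = pverts X"
    unfolding vertex_list_def
    by (rule someI_ex) (use finite_distinct_list[OF assms] in blast)
  then show ?thesis
    by (metis bij_betw_nth distinct_card)
qed

lemma cheb_mat_eq_cheb_walks:
  assumes "A = mat n n (\<lambda>(i, j). of_bool (E i j))" "i < n" "l < n"
  shows "cheb_mat c A j $$ (i, l) = cheb_walks {..<n} E c j i l"
  using assms(2,3)
proof (induction j arbitrary: i l rule: induct_nat_012)
  case (ge2 j)
  have A: "A \<in> carrier_mat n n" by (simp add: assms(1))
  note c = cheb_mat_carrier[OF A, of c]
  have "(A * cheb_mat c A (Suc j)) $$ (i, l) = (\<Sum>v<n. of_bool (E i v) * cheb_mat c A (Suc j) $$ (v, l))"
    using ge2(3,4) A c[of "Suc j"] by (simp add: scalar_prod_def lessThan_atLeast0 assms(1))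
  also have "\<dots> = (\<Sum>v<n. if E i v then cheb_walks {..<n} E c (Suc j) v l else 0)"
    using ge2 by (intro sum.cong) auto
  also have "\<dots> = (\<Sum>v | v \<in> {..<n} \<and> E i v. cheb_walks {..<n} E c (Suc j) v l)"
    by (simp add: sum.If_cases Int_def)
  finally show ?case
    using ge2 A c[of "Suc j"] c[of j] by (simp del: index_mult_mat(1))
qed (use assms in auto)

text \<open>The linear programming bound for an abstract f: the trace of f(A / q) is estimated from
  below through the coefficients and from above through the eigenvalues.\<close>

lemma regular_graph_card_bound:
  fixes X :: "'a pair_pre_digraph"
  assumes X: "connected_regular_graph k X" "mu1 X \<le> z" and k: "k \<ge> 2"
    and c: "\<And>j. 0 \<le> c j" and f: "\<And>x. f x = (\<Sum>j=0..N. c j * cheb_V j x)"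
    and f_le: "\<And>x. x \<le> L_bound k \<Longrightarrow> f x \<le> M"
    and f_nonpos: "\<And>x. x \<le> z / sqrt (real k - 1) \<Longrightarrow> f x \<le> 0"
  shows "c 0 * real (card (pverts X)) \<le> M"
proof -
  interpret pair_graph X using X(1) by (simp add: connected_regular_graph_def)
  have fin: "finite (pverts X)" by (rule pair_finite_verts)
  define n where "n = card (pverts X)"
  define E where "E i j \<longleftrightarrow> (vertex_list X ! i, vertex_list X ! j) \<in> parcs X" for i j
  note bij = bij_betw_vertex_list[OF fin, folded n_def]
  have sym: "E i j \<Longrightarrow> E j i" for i j
    using pair_sym_arcs unfolding E_def symmetric_def sym_def by simp
  have deg: "card {j \<in> {..<n}. E i j} = k" if i: "i < n" for i
  proof -
    let ?u = "vertex_list X ! i"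
    have u: "?u \<in> pverts X" using bij i by (auto simp: bij_betw_def)
    have "bij_betw (\<lambda>j. (?u, vertex_list X ! j)) {j \<in> {..<n}. E i j} (out_arcs (with_proj X) ?u)"
    proof (rule bij_betw_imageI)
      show "inj_on (\<lambda>j. (?u, vertex_list X ! j)) {j \<in> {..<n}. E i j}"
        using bij by (auto simp: bij_betw_def inj_on_def)
      show "(\<lambda>j. (?u, vertex_list X ! j)) ` {j \<in> {..<n}. E i j} = out_arcs (with_proj X) ?u"
      proof (intro equalityI subsetI)
        fix e assume "e \<in> out_arcs (with_proj X) ?u"
        then obtain w where e: "e = (?u, w)" "(?u, w) \<in> parcs X"
          by (cases e) (auto simp: out_arcs_def)
        then have "w \<in> pverts X" by (blast dest: in_arcsD2)
        then obtain j where "j < n" "w = vertex_list X ! j" using bij by (auto simp: bij_betw_def)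
        with e show "e \<in> (\<lambda>j. (?u, vertex_list X ! j)) ` {j \<in> {..<n}. E i j}"
          by (auto simp: E_def)
      qed (auto simp: out_arcs_def E_def)
    qed
    then have "card {j \<in> {..<n}. E i j} = out_degree (with_proj X) ?u"
      unfolding out_degree_def by (rule bij_betw_same_card)
    then show ?thesis using X(1) u by (simp add: connected_regular_graph_def regular_graph_def)
  qed
  define A where "A = adj_mat X"
  have A_eq: "A = mat n n (\<lambda>(i, j). of_bool (E i j))"
    unfolding A_def adj_mat_def n_def E_def by (intro cong_mat) auto
  have A: "A \<in> carrier_mat n n" by (simp add: A_eq)
  have A_sym: "A $$ (i, j) = A $$ (j, i)" if "i < n" "j < n" for i j
    using that sym by (auto simp: A_eq)
  obtain es where es: "char_poly A = (\<Prod>e\<leftarrow>es. [:- e, 1:])" "length es = n"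
    using symmetric_char_poly_splits[OF A A_sym] by blast
  define evs where "evs = adj_eigenvalues X"
  have evs: "mset evs = mset es" "sorted (rev evs)"
    unfolding evs_def adj_eigenvalues_def A_def[symmetric] es(1) proots_linear_factors by simp_all
  have len: "length evs = n" using evs(1) es(2) by (metis size_mset)
  define q where "q = sqrt (real k - 1)"
  have q: "q > 0" and q2: "q\<^sup>2 = real k - 1" using k by (auto simp: q_def)
  have trace_nonneg: "0 \<le> (\<Sum>e\<leftarrow>evs. cheb_V j (e / q))" for j
  proof -
    have "0 \<le> (\<Sum>i<n. cheb_mat (q\<^sup>2) A j $$ (i, i))"
      unfolding q2
      by (intro sum_nonneg) (auto simp: cheb_mat_eq_cheb_walks[OF A_eq] intro!: cheb_walks_nonneg deg sym)
    also have "\<dots> = q ^ j * (\<Sum>e\<leftarrow>es. cheb_V j (e / q))"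
      using q by (intro trace_cheb_mat[OF A es(1)]) simp
    also have "(\<Sum>e\<leftarrow>es. cheb_V j (e / q)) = (\<Sum>e\<leftarrow>evs. cheb_V j (e / q))"
      using evs(1) by (metis mset_map sum_mset_sum_list)
    finally show ?thesis using zero_less_power[OF q, of j] by (meson not_le mult_pos_neg)
  qed
  have "c 0 * real n = (\<Sum>e\<leftarrow>evs. c 0 * cheb_V 0 (e / q))"
    by (simp add: cheb_V_simps(1) len sum_list_triv)
  \<comment> \<open>All terms but j = 0 may be dropped: each is a nonnegative coefficient times a
    nonnegative trace.\<close>
  also have "\<dots> \<le> (\<Sum>j=0..N. \<Sum>e\<leftarrow>evs. c j * cheb_V j (e / q))"
    using c trace_nonneg
    by (intro member_le_sum) (auto simp: sum_list_const_mult)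
  also have "\<dots> = (\<Sum>e\<leftarrow>evs. f (e / q))"
    unfolding f by (induction evs) (simp_all add: sum.distrib)
  finally have lower: "c 0 * real n \<le> (\<Sum>e\<leftarrow>evs. f (e / q))" .
  show ?thesis
  proof (cases evs)
    case Nil
    have "pverts X \<noteq> {}"
      using X(1) by (simp add: connected_regular_graph_def Digraph_Component.connected_def strongly_connected_def)
    then show ?thesis using Nil len fin by (simp add: n_def)
  next
    case (Cons e0 rest)
    have "e0 \<in> set es" using evs(1) Cons by (metis list.set_intros(1) set_mset_mset)
    then have "eigenvalue A e0"
      unfolding eigenvalue_root_char_poly[OF A] es(1)
      by (force simp: poly_prod_list prod_list_zero_iff)
    then have "e0 \<le> real k"
    proof (rule eigenvalue_le_row_sum[OF A, rotated 2])
      fix i assume i: "i < n"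
      show "(\<Sum>j<n. A $$ (i, j)) = real k"
        using i deg[OF i] by (simp add: A_eq of_bool_def sum.If_cases Int_def)
    qed (auto simp: A_eq)
    then have "f (e0 / q) \<le> M"
      using q by (intro f_le) (simp add: L_bound_def q_def divide_right_mono)
    moreover have "f (e / q) \<le> 0" if e: "e \<in> set rest" for e
    proof -
      \<comment> \<open>\<open>mu1\<close> is the entry at index 1, which exists because
        \<open>rest\<close> contains e.\<close>
      obtain e1 rest' where r: "rest = e1 # rest'" using e by (cases rest) auto
      have "e \<le> e1" using evs(2) e unfolding Cons r by (auto simp: sorted_append)
      also have "\<dots> = mu1 X" by (simp add: mu1_def evs_def[symmetric] Cons r)
      also have "\<dots> \<le> z" by (rule X(2))
      finally show ?thesis using q by (intro f_nonpos) (simp add: q_def divide_right_mono)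
    qed
    then have "(\<Sum>e\<leftarrow>rest. f (e / q)) \<le> 0" by (intro sum_list_nonpos) auto
    ultimately show ?thesis using lower by (simp add: n_def Cons)
  qed
qed

text \<open>\<open>k \<ge> 2\<close> keeps the divisor sqrt(k - 1) nonzero. Existence of the
  expansion is stated first, and the bound then for every expansion. Attainment of
  \<open>M_max\<close> is stated because \<open>GREATEST\<close> is meaningful only then.\<close>

theorem theorem4p7:
  fixes z s :: real and k m :: nat
  assumes "k \<ge> 2" and "z < 2 * sqrt (real k - 1)"
    and "m \<ge> 1" and "z / sqrt (real k - 1) < alpha m"
    and "0 < s" and "s < alpha m - z / sqrt (real k - 1)"
  shows
    "(\<exists>c :: nat \<Rightarrow> real. \<forall>x. F_shift m s x = (\<Sum>j=0..2*m-1. c j * cheb_V j x)) \<and>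
     M_max z k m s \<in> F_shift m s ` {z / sqrt (real k - 1) .. L_bound k} \<and>
     (\<forall>x \<in> {z / sqrt (real k - 1) .. L_bound k}. F_shift m s x \<le> M_max z k m s) \<and>
     M_max z k m s = F_hat m (L_bound k + s) \<and>
     (\<forall>c :: nat \<Rightarrow> real. (\<forall>x. F_shift m s x = (\<Sum>j=0..2*m-1. c j * cheb_V j x)) \<longrightarrow>
        c 0 \<noteq> 0 \<and>
        (\<forall>X :: 'a pair_pre_digraph. connected_regular_graph k X \<and> mu1 X \<le> z \<longrightarrow>
           real (card (pverts X)) \<le> M_max z k m s / c 0) \<and>
        real (v_max k z) \<le> M_max z k m s / c 0)"
proof -
  note m = assms(3)
  let ?I = "{z / sqrt (real k - 1) .. L_bound k}"
  define M where "M = F_hat m (L_bound k + s)"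
  have L: "2 \<le> L_bound k"
  proof -
    define q where "q = sqrt (real k - 1)"
    have q: "q > 0" "q\<^sup>2 = real k - 1" using assms(1) by (auto simp: q_def)
    \<comment> \<open>AM-GM, since \<open>L_bound k\<close> is q + 1/q.\<close>
    have "0 \<le> (q - 1)\<^sup>2" by simp
    then have "2 * q \<le> real k" using q(2) by (simp add: power2_diff)
    then show ?thesis using q(1) by (simp add: L_bound_def q_def[symmetric] field_simps)
  qed
  have L_alpha: "alpha m < L_bound k" using cheb_V_alpha(4)[OF m] L by simp
  have F_le: "F_shift m s x \<le> M" if "x \<le> L_bound k" for x
    unfolding F_shift_def M_def using that L_alpha assms(5) by (intro F_hat_le[OF m]) auto
  have M_in: "M \<in> F_shift m s ` ?I"
    using assms(4) L_alpha by (auto simp: M_def F_shift_def)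
  have M_max: "M_max z k m s = M"
    unfolding M_max_def using M_in F_le by (intro Greatest_equality) auto
  have F_nonpos: "F_shift m s x \<le> 0" if "x \<le> z / sqrt (real k - 1)" for x
    unfolding F_shift_def using that assms(6) by (intro F_hat_nonpos[OF m]) simp
  \<comment> \<open>\<open>F_hat\<close> is 0 at \<open>alpha m\<close>, by x / 0 = 0. Nonnegativity
    serves the case where no graph qualifies and \<open>v_max\<close> is 0.\<close>
  have M_nonneg: "0 \<le> M"
    using F_hat_le[OF m, of "alpha m" "L_bound k + s"] L_alpha assms(5) by (simp add: M_def F_hat_def)
  obtain d where d: "\<And>j. 0 \<le> d j" "0 < d 0"
    "\<And>x. F_shift m s x = (\<Sum>j=0..2*m-1. d j * cheb_V j x)"
    using F_shift_expansion[OF m assms(5)] by blast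
  note bound = regular_graph_card_bound[where z = z, OF _ _ assms(1) d(1,3) F_le F_nonpos]
  have v_bound: "real (v_max k z) \<le> M / d 0"
  proof -
    let ?S = "{card (pverts X) | X :: nat pair_pre_digraph. connected_regular_graph k X \<and> mu1 X \<le> z}"
    have le: "real n \<le> M / d 0" if "n \<in> ?S" for n
      using that bound[where 'a = nat] d(2) by (auto simp: pos_le_divide_eq mult.commute)
    \<comment> \<open>The uniform bound makes the set finite, so a nonempty \<open>?S\<close>
      attains its supremum.\<close>
    have "?S \<subseteq> {..nat \<lfloor>M / d 0\<rfloor>}"
    proof
      fix n assume "n \<in> ?S"
      from le_nat_floor[OF le[OF this]] show "n \<in> {..nat \<lfloor>M / d 0\<rfloor>}" by simp
    qed
    then have fin: "finite ?S" by (rule finite_subset) simp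
    show ?thesis
    proof (cases "?S = {}")
      case True
      then show ?thesis using M_nonneg d(2) unfolding v_max_def True by simp
    next
      case False
      then have "v_max k z = Max ?S" unfolding v_max_def Sup_nat_def by (rule if_not_P)
      then have "v_max k z \<in> ?S" using Max_in[OF fin False] by (simp only:)
      then show ?thesis by (rule le)
    qed
  qed
  \<comment> \<open>Linear independence transfers the bound from the constructed d to any given
    coefficients.\<close>
  have c_d: "c 0 = d 0" if "\<forall>x. F_shift m s x = (\<Sum>j=0..2*m-1. c j * cheb_V j x)" for c
  proof (rule cheb_V_coeffs_unique)
    fix x
    show "(\<Sum>j=0..2*m-1. c j * cheb_V j x) = (\<Sum>j=0..2*m-1. d j * cheb_V j x)"
      using spec[OF that, of x] d(3)[of x] by (rule trans[OF sym])
  qed simp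
  show ?thesis
    unfolding M_max
  proof (intro conjI allI impI ballI)
    show "\<exists>c. \<forall>x. F_shift m s x = (\<Sum>j=0..2*m-1. c j * cheb_V j x)" using d(3) by blast
    show "M = F_hat m (L_bound k + s)" by (rule M_def)
    show "M \<in> F_shift m s ` ?I" by (rule M_in)
    show "F_shift m s x \<le> M" if "x \<in> ?I" for x using that F_le by simp
  next
    fix c assume "\<forall>x. F_shift m s x = (\<Sum>j=0..2*m-1. c j * cheb_V j x)"
    note c = c_d[OF this]
    show "c 0 \<noteq> 0" using c d(2) by simp
    show "real (v_max k z) \<le> M / c 0" using c v_bound by simp
    show "real (card (pverts X)) \<le> M / c 0" if "connected_regular_graph k X \<and> mu1 X \<le> z"
      for X :: "'a pair_pre_digraph" using c bound[of X] that d(2) by (simp add: pos_le_divide_eq mult.commute)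
  qed
qed

end
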